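(* Let $s\ge 1$ and let $L$ be a fixed set of $s$ positive integers with $L\ne[s]=\{1,\ldots,s\}$. If $\mathcal{F}\subseteq 2^{[n]}$ is $L$-differencing, then, as $n\to\infty$, $$|\mathcal{F}|\le\left(\frac{s}{s+1}+o_{L}(1)\right)\binom{n}{s}.$$ That is, for every $\varepsilon>0$ there is $n_0=n_0(L,\varepsilon)$ such that for every $n\ge n_0$ every $L$-differencing family $\mathcal{F}\subseteq 2^{[n]}$ satisfies $|\mathcal{F}|\le\left(\frac{s}{s+1}+\varepsilon\right)\binom{n}{s}$.
   Context: For a positive integer $m$, $[m]=\{1,\ldots,m\}$. For a nonempty set $L$ of positive integers, a family $\mathcal{F}\subseteq 2^{[n]}$ of subsets of $[n]$ is called $L$-differencing if $|A\setminus B|\in L$ for every ordered pair of distinct members $A,B\in\mathcal{F}$. The term $o_L(1)$ denotes a quantity depending only on $L$ and $n$ that tends to $0$ as $n\to\infty$ with $L$ fixed. *)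

theory Defs
  imports Complex_Main
begin

(* Only meant for families of finite sets: card (A - B) is 0 when A - B is infinite. *)
definition differencing :: "nat set \<Rightarrow> nat set set \<Rightarrow> bool" where
  "differencing L F \<longleftrightarrow> (\<forall>A\<in>F. \<forall>B\<in>F. A \<noteq> B \<longrightarrow> card (A - B) \<in> L)"

end

theory Submission
  imports Defs
begin

text \<open>
  Fix \<open>A0\<close> in \<open>F\<close> and let \<open>Z A\<close> be the symmetric difference of \<open>A\<close> and \<open>A0\<close>; its size is at most
  \<open>2 * Max L\<close>, and \<open>card (A - B) = card (A - A0) + card (A0 - B) - card (Z A \<inter> Z B)\<close>. The product of
  \<open>card (A - B) - l\<close> over \<open>l \<in> L\<close> vanishes for distinct \<open>A, B\<close>. Expanding it in binomials of
  \<open>card (Z A \<inter> Z B)\<close> shows that \<open>W W\<^sup>T\<close>, for \<open>W\<close> the incidence matrix of the sets \<open>Z A\<close> against the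
  \<open>s\<close>-subsets of \<open>[n]\<close>, equals \<open>\<mu>\<close> times the identity up to a matrix of rank \<open>O(n ^ (s - 1))\<close>, with
  \<open>\<mu> = \<Prod>L / s! \<ge> (s + 1) / s\<close> because \<open>L \<noteq> [s]\<close>.
  If \<open>W W\<^sup>T\<close> were exactly \<open>\<mu>\<close> times the identity, each row of the 0/1 matrix \<open>W\<close> would own \<open>\<mu>\<close> columns,
  giving \<open>\<mu> * card F \<le> n choose s\<close>. The low-rank error is removed at the cost of a few rows:
  once the few columns of large degree are moved into the error term, the error is a sparse matrix,
  and a sparse matrix of small rank has few nonzero rows.
\<close>

section \<open>Linear algebra: rank, diagonal submatrices and sparse matrices\<close>

text \<open>Gaussian elimination: an equation with a nonzero coefficient at \<open>x0\<close>
  determines that unknown, and substituting it into the others leaves one equation and one unknown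
  fewer.\<close>

lemma homogeneous_system_nontrivial_solution:
  fixes a :: "'i \<Rightarrow> 'a \<Rightarrow> 'k::field"
  assumes "finite T" "finite M" "card T < card M"
  shows "\<exists>c. (\<exists>x\<in>M. c x \<noteq> 0) \<and> (\<forall>t\<in>T. (\<Sum>x\<in>M. c x * a t x) = 0)"
  using assms
proof (induction T arbitrary: M a rule: finite_induct)
  case empty
  then have "M \<noteq> {}" by auto
  then show ?case by (intro exI[of _ "\<lambda>_. 1"]) auto
next
  case (insert t T)
  show ?case
  proof (cases "\<forall>x\<in>M. a t x = 0")
    case True
    have "card T < card M" using insert by simp
    then obtain c where "\<exists>x\<in>M. c x \<noteq> 0" "\<forall>u\<in>T. (\<Sum>x\<in>M. c x * a u x) = 0"
      using insert.IH[of M a] insert.prems(1) by blast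
    with True show ?thesis by (intro exI[of _ c]) auto
  next
    case False
    then obtain x0 where x0: "x0 \<in> M" "a t x0 \<noteq> 0" by blast
    define M' where "M' = M - {x0}"
    have fin: "finite M'" using insert.prems by (simp add: M'_def)
    have split: "(\<Sum>x\<in>M. f x) = f x0 + (\<Sum>x\<in>M'. f x)" for f :: "'a \<Rightarrow> 'k"
      using x0(1) insert.prems(1) by (simp add: M'_def sum.remove)
    have "card T < card M'"
      using insert.prems insert.hyps x0(1) by (simp add: M'_def card_Diff_singleton)
    from insert.IH[OF fin this, of "\<lambda>u x. a u x - a u x0 * a t x / a t x0"]
    obtain c where c: "\<exists>x\<in>M'. c x \<noteq> 0"
      "\<And>u. u \<in> T \<Longrightarrow> (\<Sum>x\<in>M'. c x * (a u x - a u x0 * a t x / a t x0)) = 0"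
      by blast
    define e where "e = - (\<Sum>x\<in>M'. c x * a t x) / a t x0"
    define c' where "c' = c(x0 := e)"
    have sum': "(\<Sum>x\<in>M. c' x * a u x) = e * a u x0 + (\<Sum>x\<in>M'. c x * a u x)" for u
    proof -
      have "(\<Sum>x\<in>M'. c' x * a u x) = (\<Sum>x\<in>M'. c x * a u x)"
        by (rule sum.cong) (auto simp: c'_def M'_def)
      then show ?thesis by (simp add: split c'_def)
    qed
    have "(\<Sum>x\<in>M. c' x * a t x) = 0"
      using x0(2) by (simp add: sum' e_def)
    moreover have "(\<Sum>x\<in>M. c' x * a u x) = 0" if "u \<in> T" for u
    proof -
      have "0 = (\<Sum>x\<in>M'. c x * a u x) - (\<Sum>x\<in>M'. (a u x0 / a t x0) * (c x * a t x))"
        unfolding c(2)[OF that, symmetric]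
        by (simp add: sum_subtractf[symmetric] algebra_simps)
      also have "\<dots> = (\<Sum>x\<in>M'. c x * a u x) + e * a u x0"
        by (simp only: sum_distrib_left[symmetric]) (simp add: e_def)
      finally show ?thesis by (simp add: sum' add.commute)
    qed
    moreover have "\<exists>x\<in>M. c' x \<noteq> 0"
      using c(1) by (auto simp: c'_def M'_def)
    ultimately show ?thesis by blast
  qed
qed

text \<open>With more rows than \<open>card J\<close>, some nontrivial combination \<open>c\<close>
  of the rows \<open>a\<close> vanishes in every coordinate \<open>j\<close>. Pairing it with a
  column \<open>y\<close> where \<open>c y \<noteq> 0\<close> leaves \<open>c y\<close> times a
  nonzero diagonal entry.\<close>

lemma diagonal_le_rank:
  fixes a b :: "'i \<Rightarrow> 'a \<Rightarrow> 'k::field"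
  assumes "finite J" "finite M"
    and diag: "\<And>x. x \<in> M \<Longrightarrow> (\<Sum>j\<in>J. a j x * b j x) \<noteq> 0"
    and off: "\<And>x y. \<lbrakk>x \<in> M; y \<in> M; x \<noteq> y\<rbrakk> \<Longrightarrow> (\<Sum>j\<in>J. a j x * b j y) = 0"
  shows "card M \<le> card J"
proof (rule ccontr)
  assume "\<not> ?thesis"
  then obtain c where c: "\<exists>x\<in>M. c x \<noteq> 0" "\<And>j. j \<in> J \<Longrightarrow> (\<Sum>x\<in>M. c x * a j x) = 0"
    using homogeneous_system_nontrivial_solution[OF assms(1,2), of a] by force
  then obtain y where y: "y \<in> M" "c y \<noteq> 0" by blast
  have "0 = (\<Sum>j\<in>J. (\<Sum>x\<in>M. c x * a j x) * b j y)" by (simp add: c(2))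
  also have "\<dots> = (\<Sum>j\<in>J. \<Sum>x\<in>M. c x * (a j x * b j y))"
    by (simp add: sum_distrib_right mult.assoc)
  also have "\<dots> = (\<Sum>x\<in>M. \<Sum>j\<in>J. c x * (a j x * b j y))"
    by (rule sum.swap)
  also have "\<dots> = (\<Sum>x\<in>M. c x * (\<Sum>j\<in>J. a j x * b j y))"
    by (simp add: sum_distrib_left)
  also have "\<dots> = (\<Sum>x\<in>M. if x = y then c y * (\<Sum>j\<in>J. a j y * b j y) else 0)"
    using off y(1) by (intro sum.cong) auto
  also have "\<dots> = c y * (\<Sum>j\<in>J. a j y * b j y)"
    using y(1) assms(2) by simp
  finally show False using y diag by simp
qed

text \<open>A maximal set of rows that, with chosen nonzero entries, forms a diagonal submatrix has at most
  rank many elements, and sparsity makes every nonzero row conflict with one of them.\<close>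
lemma sparse_nonzero_rows_le_rank:
  fixes a b :: "'i \<Rightarrow> 'a \<Rightarrow> 'k::field"
  assumes "finite J" "finite F"
    and R: "\<And>x y. \<lbrakk>x \<in> F; y \<in> F\<rbrakk> \<Longrightarrow> R x y = (\<Sum>j\<in>J. a j x * b j y)"
    and row: "\<And>x. x \<in> F \<Longrightarrow> card {y\<in>F. R x y \<noteq> 0} \<le> q"
    and col: "\<And>y. y \<in> F \<Longrightarrow> card {x\<in>F. R x y \<noteq> 0} \<le> q"
  shows "card {x\<in>F. \<exists>y\<in>F. R x y \<noteq> 0} \<le> (q + q * q) * card J"
proof -
  define G where "G = {x\<in>F. \<exists>y\<in>F. R x y \<noteq> 0}"
  have "\<forall>x\<in>G. \<exists>y. y \<in> F \<and> R x y \<noteq> 0" by (auto simp: G_def)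
  then obtain p where p: "\<And>x. x \<in> G \<Longrightarrow> p x \<in> F \<and> R x (p x) \<noteq> 0"
    by metis
  have GF: "G \<subseteq> F" and finG: "finite G" using assms(2) by (auto simp: G_def)
  define ind where "ind = {M. M \<subseteq> G \<and> (\<forall>x\<in>M. \<forall>y\<in>M. x \<noteq> y \<longrightarrow> R x (p y) = 0)}"
  have "finite ind" unfolding ind_def using finG by auto
  moreover have "{} \<in> ind" by (simp add: ind_def)
  ultimately obtain M where M: "M \<in> ind" "\<And>M'. M' \<in> ind \<Longrightarrow> M \<subseteq> M' \<Longrightarrow> M = M'"
    using finite_has_maximal[of ind] by blast
  have MG: "M \<subseteq> G" and Mi: "\<And>x y. \<lbrakk>x \<in> M; y \<in> M; x \<noteq> y\<rbrakk> \<Longrightarrow> R x (p y) = 0"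
    using M(1) by (auto simp: ind_def)
  have finM: "finite M" using MG finG finite_subset by blast
  have "card M \<le> card J"
  proof (rule diagonal_le_rank[OF assms(1) finM, of a "\<lambda>j x. b j (p x)"])
    show "(\<Sum>j\<in>J. a j x * b j (p x)) \<noteq> 0" if "x \<in> M" for x
      using that MG GF p[of x] R[of x "p x", symmetric] by (simp add: subset_iff)
    show "(\<Sum>j\<in>J. a j x * b j (p y)) = 0" if "x \<in> M" "y \<in> M" "x \<noteq> y" for x y
      using that MG GF p[of y] R[of x "p y", symmetric] Mi[of x y] by (simp add: subset_iff)
  qed
  \<comment> \<open>By maximality, for each \<open>x\<close> in \<open>G\<close> some
    \<open>y\<close> in \<open>M\<close> satisfies one of two conditions: row \<open>x\<close> is
    nonzero in column \<open>p y\<close>, or rows \<open>x\<close> and \<open>y\<close> are both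
    nonzero in column \<open>p x\<close>. The two cases account for \<open>q\<close> and
    \<open>q * q\<close>.\<close>
  have cover: "G \<subseteq> (\<Union>y\<in>M. {x\<in>F. R x (p y) \<noteq> 0} \<union> (\<Union>z\<in>{z\<in>F. R y z \<noteq> 0}. {x\<in>F. R x z \<noteq> 0}))"
  proof
    fix x assume x: "x \<in> G"
    have "\<exists>y\<in>M. R x (p y) \<noteq> 0 \<or> R y (p x) \<noteq> 0"
    proof (cases "x \<in> M")
      case True
      then show ?thesis using p x by blast
    next
      case False
      have "insert x M \<notin> ind" using M(2)[of "insert x M"] False by blast
      then show ?thesis using x MG Mi by (auto simp: ind_def)
    qed
    then show "x \<in> (\<Union>y\<in>M. {x\<in>F. R x (p y) \<noteq> 0} \<union> (\<Union>z\<in>{z\<in>F. R y z \<noteq> 0}. {x\<in>F. R x z \<noteq> 0}))"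
      using x p[OF x] GF by blast
  qed
  have each: "card ({x\<in>F. R x (p y) \<noteq> 0} \<union> (\<Union>z\<in>{z\<in>F. R y z \<noteq> 0}. {x\<in>F. R x z \<noteq> 0})) \<le> q + q * q"
    if "y \<in> M" for y
  proof -
    have yF: "y \<in> F" "p y \<in> F" using that MG GF p by auto
    have "card (\<Union>z\<in>{z\<in>F. R y z \<noteq> 0}. {x\<in>F. R x z \<noteq> 0})
        \<le> (\<Sum>z\<in>{z\<in>F. R y z \<noteq> 0}. card {x\<in>F. R x z \<noteq> 0})"
      by (rule card_UN_le) (use assms(2) in auto)
    also have "\<dots> \<le> card {z\<in>F. R y z \<noteq> 0} * q"
      using sum_bounded_above[of "{z\<in>F. R y z \<noteq> 0}" "\<lambda>z. card {x\<in>F. R x z \<noteq> 0}" q] col by auto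
    also have "\<dots> \<le> q * q" using row[OF yF(1)] by simp
    finally show ?thesis
      using card_Un_le[of "{x\<in>F. R x (p y) \<noteq> 0}" "\<Union>z\<in>{z\<in>F. R y z \<noteq> 0}. {x\<in>F. R x z \<noteq> 0}"]
        col[OF yF(2)] by linarith
  qed
  have "card G \<le> card (\<Union>y\<in>M. {x\<in>F. R x (p y) \<noteq> 0} \<union> (\<Union>z\<in>{z\<in>F. R y z \<noteq> 0}. {x\<in>F. R x z \<noteq> 0}))"
    by (rule card_mono[OF _ cover]) (use finM assms(2) in auto)
  also have "\<dots> \<le> (\<Sum>y\<in>M. card ({x\<in>F. R x (p y) \<noteq> 0} \<union> (\<Union>z\<in>{z\<in>F. R y z \<noteq> 0}. {x\<in>F. R x z \<noteq> 0})))"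
    by (rule card_UN_le[OF finM])
  also have "\<dots> \<le> card M * (q + q * q)"
    using sum_bounded_above[of M _ "q + q * q", OF each] by simp
  also have "\<dots> \<le> (q + q * q) * card J"
    using mult_le_mono1[OF \<open>card M \<le> card J\<close>] by (simp add: mult.commute)
  finally show ?thesis by (simp add: G_def)
qed

section \<open>Bounding the number of rows by splitting the columns by degree\<close>

lemma sum_degrees_le:
  assumes "finite F" "finite X" "\<And>A. A \<in> F \<Longrightarrow> E A \<subseteq> X" "\<And>A. A \<in> F \<Longrightarrow> card (E A) \<le> k"
  shows "(\<Sum>S\<in>X. card {A\<in>F. S \<in> E A}) \<le> k * card F"
proof -
  have "(\<Sum>S\<in>X. card {A\<in>F. S \<in> E A}) = (\<Sum>A\<in>F. card {S\<in>X. S \<in> E A})"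
    using assms(1,2) by (intro sum_multicount_gen) auto
  also have "\<dots> = (\<Sum>A\<in>F. card (E A))"
    using assms(3) by (intro sum.cong arg_cong[of _ _ card]) auto
  also have "\<dots> \<le> k * card F"
    using sum_bounded_above[of F "\<lambda>A. card (E A)" k] assms(4) by (simp add: mult.commute)
  finally show ?thesis .
qed

text \<open>Rows meeting a column of medium degree are discarded, at the cost of the middle term.
  Columns of degree above \<open>D'\<close> are few, so moving them into the low-rank part adds at
  most \<open>k * card F / D'\<close> to the rank. The remaining error is sparse, so
  \<open>sparse_nonzero_rows_le_rank\<close> applies; the rows on which it vanishes own disjoint
  sets of \<open>\<mu>\<close> columns.\<close>

lemma card_le_at_scale:
  fixes E :: "'a \<Rightarrow> 'b set" and \<mu> :: real and a b :: "'i \<Rightarrow> 'a \<Rightarrow> real" and D D' k :: nat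
  assumes fin: "finite F" "finite X" "finite I"
    and EX: "\<And>A. A \<in> F \<Longrightarrow> E A \<subseteq> X"
    and Ek: "\<And>A. A \<in> F \<Longrightarrow> card (E A) \<le> k"
    and "\<mu> > 0" "0 < D'" "D \<le> D'"
    and gram: "\<And>A B. \<lbrakk>A \<in> F; B \<in> F\<rbrakk> \<Longrightarrow>
      real (card (E A \<inter> E B)) = (if A = B then \<mu> else 0) + (\<Sum>i\<in>I. a i A * b i B)"
  defines "deg \<equiv> \<lambda>S. card {A\<in>F. S \<in> E A}" and "q \<equiv> 1 + k * D"
  shows "real (card F) \<le> real (card X) / \<mu> + real (\<Sum>S | S \<in> X \<and> D < deg S \<and> deg S \<le> D'. deg S)
    + real (q + q * q) * (real k * real (card F) / real D' + real (card I))"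
proof -
  define light where "light = {S\<in>X. deg S \<le> D}"
  define mid where "mid = {S\<in>X. D < deg S \<and> deg S \<le> D'}"
  define heavy where "heavy = {S\<in>X. D' < deg S}"
  define F1 where "F1 = {A\<in>F. E A \<inter> mid = {}}"
  define R where "R A B = real (card (E A \<inter> E B \<inter> light)) - (if A = B then \<mu> else 0)" for A B
  define F2 where "F2 = {A\<in>F1. \<exists>B\<in>F1. R A B \<noteq> 0}"
  define F3 where "F3 = F1 - F2"
  have fins: "finite light" "finite mid" "finite heavy" "finite F1" "finite F2" "finite F3"
    using fin by (auto simp: light_def mid_def heavy_def F1_def F2_def F3_def)
  have F1F: "F1 \<subseteq> F" by (auto simp: F1_def)
  have finE: "finite (E A)" if "A \<in> F" for A using EX[OF that] fin(2) finite_subset by blast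
  have symR: "R A B = R B A" for A B by (simp add: R_def Int_commute)

  have F_F1: "real (card (F - F1)) \<le> real (\<Sum>S\<in>mid. deg S)"
  proof -
    have "F - F1 \<subseteq> (\<Union>S\<in>mid. {A\<in>F. S \<in> E A})" by (auto simp: F1_def)
    then have "card (F - F1) \<le> card (\<Union>S\<in>mid. {A\<in>F. S \<in> E A})"
      by (intro card_mono) (use fins fin in auto)
    also have "\<dots> \<le> (\<Sum>S\<in>mid. card {A\<in>F. S \<in> E A})" by (rule card_UN_le[OF fins(2)])
    finally show ?thesis by (simp only: deg_def of_nat_le_iff)
  qed
  have F_split: "real (card F) = real (card (F - F1)) + real (card F2) + real (card F3)"
  proof -
    have "card F = card (F - F1) + card F1"
      using F1F fin(1) fins(4) by (simp add: card_Diff_subset card_mono)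
    moreover have "card F1 = card F2 + card F3"
      using fins(4) unfolding F3_def F2_def by (subst card_Diff_subset) (auto simp: card_mono)
    ultimately show ?thesis by simp
  qed
  have F2: "card F2 \<le> (q + q * q) * (card I + card heavy)"
  proof -
    \<comment> \<open>Heavy columns enter with a minus sign because they are subtracted from the
      full Gram matrix to leave the light one.\<close>
    define a' where "a' = case_sum a (\<lambda>S A. - of_bool (S \<in> E A) :: real)"
    define b' where "b' = case_sum b (\<lambda>S A. of_bool (S \<in> E A) :: real)"
    have rep: "R A B = (\<Sum>j\<in>I <+> heavy. a' j A * b' j B)" if "A \<in> F1" "B \<in> F1" for A B
    proof -
      have AB: "A \<in> F" "B \<in> F" using that F1F by auto
      have "E A \<inter> E B = (E A \<inter> E B \<inter> light) \<union> (E A \<inter> E B \<inter> heavy)"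
        using that EX[OF AB(1)] by (auto simp: F1_def light_def heavy_def mid_def)
      moreover have "card ((E A \<inter> E B \<inter> light) \<union> (E A \<inter> E B \<inter> heavy))
          = card (E A \<inter> E B \<inter> light) + card (E A \<inter> E B \<inter> heavy)"
        by (rule card_Un_disjoint) (use finE[OF AB(1)] \<open>D \<le> D'\<close> in \<open>auto simp: light_def heavy_def\<close>)
      ultimately have "real (card (E A \<inter> E B))
          = real (card (E A \<inter> E B \<inter> light)) + real (card (E A \<inter> E B \<inter> heavy))" by simp
      moreover have "real (card (E A \<inter> E B \<inter> heavy))
          = (\<Sum>S\<in>heavy. of_bool (S \<in> E A) * of_bool (S \<in> E B))"
        using fins(3) by (simp add: of_bool_conj[symmetric] sum_of_bool_eq Int_def conj_ac del: of_bool_conj)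
      ultimately have "R A B = (\<Sum>i\<in>I. a i A * b i B)
          - (\<Sum>S\<in>heavy. of_bool (S \<in> E A) * of_bool (S \<in> E B))"
        using gram[OF AB] by (simp add: R_def)
      then show ?thesis
        using fin(3) fins(3) by (simp add: sum.Plus a'_def b'_def sum_negf)
    qed
    have row: "card {B\<in>F1. R A B \<noteq> 0} \<le> q" if "A \<in> F1" for A
    proof -
      have AF: "A \<in> F" using that F1F by auto
      \<comment> \<open>Off the diagonal a nonzero entry needs a common light column:
        \<open>A\<close> has at most \<open>k\<close> of them, each lying in at most
        \<open>D\<close> rows. The diagonal entry is the 1 in \<open>q\<close>.\<close>
      have "{B\<in>F1. R A B \<noteq> 0} \<subseteq> insert A (\<Union>S\<in>E A \<inter> light. {B\<in>F. S \<in> E B})"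
      proof
        fix B assume B: "B \<in> {B\<in>F1. R A B \<noteq> 0}"
        show "B \<in> insert A (\<Union>S\<in>E A \<inter> light. {B\<in>F. S \<in> E B})"
        proof (cases "B = A")
          case False
          then have "E A \<inter> E B \<inter> light \<noteq> {}" using B by (auto simp: R_def)
          then show ?thesis using B F1F by auto
        qed simp
      qed
      then have "card {B\<in>F1. R A B \<noteq> 0} \<le> card (insert A (\<Union>S\<in>E A \<inter> light. {B\<in>F. S \<in> E B}))"
        by (intro card_mono) (use finE[OF AF] fin in auto)
      also have "\<dots> \<le> Suc (card (\<Union>S\<in>E A \<inter> light. {B\<in>F. S \<in> E B}))"
        by (rule card_insert_le_m1) auto
      also have "card (\<Union>S\<in>E A \<inter> light. {B\<in>F. S \<in> E B}) \<le> (\<Sum>S\<in>E A \<inter> light. deg S)"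
        unfolding deg_def by (rule card_UN_le) (use finE[OF AF] in auto)
      also have "\<dots> \<le> card (E A \<inter> light) * D"
        using sum_bounded_above[of "E A \<inter> light" deg D] by (auto simp: light_def)
      also have "card (E A \<inter> light) \<le> k"
        using Ek[OF AF] card_mono[OF finE[OF AF], of "E A \<inter> light"] by simp
      finally show ?thesis by (simp add: q_def)
    qed
    have "card F2 \<le> (q + q * q) * card (I <+> heavy)"
      unfolding F2_def
      by (rule sparse_nonzero_rows_le_rank[where R = R, OF _ fins(4) rep row])
        (use fin(3) fins(3) row symR in auto)
    then show ?thesis using fin(3) fins(3) by (simp add: card_Plus)
  qed
  have heavy: "real (card heavy) \<le> real k * real (card F) / real D'"
  proof -
    have "card heavy * D' \<le> (\<Sum>S\<in>heavy. deg S)"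
      using sum_bounded_below[of heavy D' deg] by (auto simp: heavy_def)
    also have "\<dots> \<le> (\<Sum>S\<in>X. deg S)"
      by (rule sum_mono2) (use fin in \<open>auto simp: heavy_def\<close>)
    also have "\<dots> \<le> k * card F"
      unfolding deg_def by (rule sum_degrees_le[OF fin(1,2) EX Ek])
    finally have "real (card heavy) * real D' \<le> real k * real (card F)"
      by (metis of_nat_le_iff of_nat_mult)
    then show ?thesis using \<open>0 < D'\<close> by (simp add: field_simps)
  qed
  have F3: "real (card F3) \<le> real (card X) / \<mu>"
  proof -
    have zero: "R A B = 0" if "A \<in> F3" "B \<in> F3" for A B
      using that by (auto simp: F3_def F2_def)
    have F3F: "F3 \<subseteq> F" using F1F by (auto simp: F3_def)
    \<comment> \<open>Vanishing diagonal entries of \<open>R\<close> give the sizes, vanishing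
      off-diagonal ones the disjointness.\<close>
    have "real (card F3) * \<mu> = (\<Sum>A\<in>F3. real (card (E A \<inter> light)))"
      using zero[of A A for A] by (simp add: R_def)
    also have "\<dots> = real (card (\<Union>A\<in>F3. E A \<inter> light))"
    proof (subst card_UN_disjoint)
      show "\<forall>A\<in>F3. \<forall>B\<in>F3. A \<noteq> B \<longrightarrow> E A \<inter> light \<inter> (E B \<inter> light) = {}"
      proof (intro ballI impI)
        fix A B assume AB: "A \<in> F3" "B \<in> F3" "A \<noteq> B"
        then have "card (E A \<inter> E B \<inter> light) = 0" using zero[of A B] by (simp add: R_def)
        then have "E A \<inter> E B \<inter> light = {}" using fins(1) by simp
        then show "E A \<inter> light \<inter> (E B \<inter> light) = {}" by blast
      qed
    qed (use fins in auto)
    also have "\<dots> \<le> real (card X)"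
      using fin(2) by (intro of_nat_mono card_mono) (auto simp: light_def)
    finally show ?thesis using \<open>\<mu> > 0\<close> by (simp add: field_simps)
  qed
  have "real (card F2) \<le> real (q + q * q) * (real k * real (card F) / real D' + real (card I))"
  proof -
    have "real (card F2) \<le> real (q + q * q) * (real (card I) + real (card heavy))"
      using F2 by (metis of_nat_add of_nat_le_iff of_nat_mult)
    also have "\<dots> \<le> real (q + q * q) * (real k * real (card F) / real D' + real (card I))"
      using heavy by (intro mult_left_mono) auto
    finally show ?thesis .
  qed
  with F_F1 F_split F3 show ?thesis unfolding mid_def by linarith
qed

text \<open>The bound at a single scale costs \<open>Q(D) k / D'\<close> for the columns of degree above \<open>D'\<close>, so \<open>D'\<close> must
  be far larger than \<open>D\<close>. Among many disjoint such ranges of degrees, one carries few incidences.\<close>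
lemma card_le_of_gram_low_rank:
  fixes \<delta> :: real and k :: nat
  assumes "\<delta> > 0"
  shows "\<exists>C\<ge>0. \<forall>(F :: 'a set) (E :: 'a \<Rightarrow> 'b set) X (I :: 'i set) \<mu> a b.
    finite F \<and> finite X \<and> finite I \<and> \<mu> > 0 \<and> (\<forall>A\<in>F. E A \<subseteq> X \<and> card (E A) \<le> k) \<and>
    (\<forall>A\<in>F. \<forall>B\<in>F. real (card (E A \<inter> E B)) = (if A = B then \<mu> else 0) + (\<Sum>i\<in>I. a i A * b i B))
    \<longrightarrow> (1 - \<delta>) * real (card F) \<le> real (card X) / \<mu> + C * real (card I)"
proof -
  define Q where "Q d = real ((1 + k * d) + (1 + k * d) * (1 + k * d))" for d
  \<comment> \<open>This growth keeps the loss from heavy columns below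
    \<open>\<delta> / 2 * card F\<close> at every scale; the other half of \<open>\<delta>\<close>
    is left for the medium columns.\<close>
  have "\<exists>D. \<forall>i. (0 < D i) \<and> (D i < D (Suc i) \<and> real k * Q (D i) \<le> \<delta> / 2 * real (D (Suc i)))"
  proof (rule dependent_nat_choice)
    show "\<exists>d::nat. 0 < d" by auto
    fix d i :: nat assume "0 < d"
    obtain e :: nat where "2 * real k * Q d / \<delta> \<le> real e" using real_arch_simple by blast
    then have "real k * Q d \<le> \<delta> / 2 * real e" using assms by (simp add: field_simps)
    also have "\<dots> \<le> \<delta> / 2 * real (Suc (d + e))" using assms by simp
    finally show "\<exists>e. 0 < e \<and> d < e \<and> real k * Q d \<le> \<delta> / 2 * real e"
      by (intro exI[of _ "Suc (d + e)"]) simp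
  qed
  then obtain D where D: "\<And>i. 0 < D i" "\<And>i. D i < D (Suc i)"
    "\<And>i. real k * Q (D i) \<le> \<delta> / 2 * real (D (Suc i))" by blast
  have D_mono: "strict_mono D" using D(2) by (simp add: strict_mono_Suc_iff)
  obtain t0 :: nat where "2 * real k / \<delta> \<le> real t0" using real_arch_simple by blast
  then have t: "real k \<le> \<delta> / 2 * real (Suc t0)"
    using assms by (simp add: field_simps)
  \<comment> \<open>Since \<open>\<delta> / 2 * t \<ge> k\<close>, the at most
    \<open>k * card F\<close> incidences cannot exceed \<open>\<delta> / 2 * card F\<close> in each
    of \<open>t\<close> disjoint ranges. The \<open>Suc\<close> provides at least one range even
    when \<open>k = 0\<close>.\<close>
  define t where "t = Suc t0"
  have Q_mono: "Q d \<le> Q e" if "d \<le> e" for d e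
    unfolding Q_def of_nat_le_iff by (intro add_mono mult_mono) (use that in auto)
  show ?thesis
  \<comment> \<open>The good scale \<open>i < t\<close> varies with the family; monotonicity of
    \<open>Q\<close> replaces it by a uniform constant.\<close>
  proof (intro exI[of _ "Q (D t)"] conjI allI impI)
    show "0 \<le> Q (D t)" by (simp add: Q_def)
    fix F :: "'a set" and E :: "'a \<Rightarrow> 'b set" and X I \<mu> and a b :: "'i \<Rightarrow> 'a \<Rightarrow> real"
    assume H: "finite F \<and> finite X \<and> finite I \<and> \<mu> > 0 \<and> (\<forall>A\<in>F. E A \<subseteq> X \<and> card (E A) \<le> k) \<and>
      (\<forall>A\<in>F. \<forall>B\<in>F. real (card (E A \<inter> E B)) = (if A = B then \<mu> else 0) + (\<Sum>i\<in>I. a i A * b i B))"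
    define deg where "deg S = card {A\<in>F. S \<in> E A}" for S
    define mid where "mid i = {S\<in>X. D i < deg S \<and> deg S \<le> D (Suc i)}" for i
    have disj: "mid i \<inter> mid j = {}" if "i \<noteq> j" for i j
    proof -
      have "mid i \<inter> mid j = {}" if "i < j" for i j
        using strict_mono_less_eq[OF D_mono, of "Suc i" j] that by (auto simp: mid_def)
      then show ?thesis using that by (metis Int_commute linorder_neqE_nat)
    qed
    have "(\<Sum>i<t. \<Sum>S\<in>mid i. deg S) = (\<Sum>S\<in>(\<Union>i<t. mid i). deg S)"
      using H disj by (subst sum.UNION_disjoint) (auto simp: mid_def)
    also have "\<dots> \<le> (\<Sum>S\<in>X. deg S)"
      by (rule sum_mono2) (use H in \<open>auto simp: mid_def\<close>)
    also have "\<dots> \<le> k * card F"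
      unfolding deg_def by (rule sum_degrees_le) (use H in auto)
    finally have total: "(\<Sum>i<t. real (\<Sum>S\<in>mid i. deg S)) \<le> real k * real (card F)"
      by (metis of_nat_le_iff of_nat_mult of_nat_sum)
    have "\<exists>i<t. real (\<Sum>S\<in>mid i. deg S) \<le> \<delta> / 2 * real (card F)"
    proof (rule ccontr)
      assume "\<not> ?thesis"
      then have "(\<Sum>i<t. \<delta> / 2 * real (card F)) < (\<Sum>i<t. real (\<Sum>S\<in>mid i. deg S))"
        by (intro sum_strict_mono) (auto simp: t_def)
      then have "\<delta> / 2 * real t * real (card F) < real k * real (card F)"
        using total by (simp add: mult_ac)
      then show False using t mult_right_mono[OF t, of "real (card F)"] by (simp add: t_def)
    qed
    then obtain i where i: "i < t" "real (\<Sum>S\<in>mid i. deg S) \<le> \<delta> / 2 * real (card F)" by blast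
    have "real (card F) \<le> real (card X) / \<mu> + real (\<Sum>S\<in>mid i. deg S)
        + Q (D i) * (real k * real (card F) / real (D (Suc i)) + real (card I))"
      unfolding mid_def deg_def Q_def
      by (rule card_le_at_scale[where a = a and b = b]) (use H D in \<open>auto intro: less_imp_le\<close>)
    moreover have "Q (D i) * (real k * real (card F) / real (D (Suc i))) \<le> \<delta> / 2 * real (card F)"
    proof -
      have "real k * Q (D i) / real (D (Suc i)) \<le> \<delta> / 2"
        using D(1)[of "Suc i"] D(3)[of i] by (simp add: divide_le_eq)
      from mult_right_mono[OF this, of "real (card F)"] show ?thesis by (simp add: mult_ac)
    qed
    moreover have "Q (D i) * real (card I) \<le> Q (D t) * real (card I)"
      using Q_mono strict_mono_less_eq[OF D_mono] i(1) by (intro mult_right_mono) auto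
    ultimately show "(1 - \<delta>) * real (card F) \<le> real (card X) / \<mu> + Q (D t) * real (card I)"
      using i(2) unfolding distrib_left left_diff_distrib by linarith
  qed
qed

section \<open>Products over \<open>L\<close>: binomial expansion and comparison with
  factorials\<close>

text \<open>A further factor is absorbed by \<open>x * (x choose t) = t * (x choose t) + (t + 1) *
  (x choose (t + 1))\<close>. The leading coefficient is kept explicit so that
  \<open>x choose card L\<close> can be isolated later.\<close>

lemma prod_diff_binomial_expansion:
  fixes a :: "'b \<Rightarrow> real"
  assumes "finite L"
  shows "\<exists>c. (\<forall>x. (\<Prod>l\<in>L. a l - real x) = (\<Sum>t\<le>card L. c t * real (x choose t))) \<and>
    c (card L) = (- 1) ^ card L * fact (card L)"
  using assms
proof (induction L rule: finite_induct)
  case empty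
  show ?case by (intro exI[of _ "\<lambda>_. 1"]) simp
next
  case (insert l L)
  define s where "s = card L"
  from insert.IH obtain c where c: "\<And>x. (\<Prod>l\<in>L. a l - real x) = (\<Sum>t\<le>s. c t * real (x choose t))"
    "c s = (- 1) ^ s * fact s"
    unfolding s_def by blast
  \<comment> \<open>The \<open>if\<close> suppresses the new top index, where the old
    \<open>c\<close> has no prescribed value; at \<open>t = 0\<close> the truncated
    \<open>t - 1\<close> is harmless because its factor is zero.\<close>
  define c' where "c' t = (if t \<le> s then (a l - real t) * c t else 0) - real t * c (t - 1)" for t
  have absorb: "real x * real (x choose t) = real t * real (x choose t) + real (Suc t) * real (x choose Suc t)"
    for x t
    using gbinomial_mult_1[of "real x" t] by (simp add: binomial_gbinomial)
  have "(\<Prod>l\<in>insert l L. a l - real x) = (\<Sum>t\<le>Suc s. c' t * real (x choose t))" for x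
  proof -
    have "(\<Prod>l\<in>insert l L. a l - real x) = (\<Sum>t\<le>s. c t * (a l * real (x choose t) - real x * real (x choose t)))"
      using insert.hyps by (simp add: c(1) sum_distrib_left algebra_simps)
    also have "\<dots> = (\<Sum>t\<le>s. (a l - real t) * c t * real (x choose t))
        - (\<Sum>t\<le>s. real (Suc t) * c t * real (x choose Suc t))"
      unfolding absorb sum_subtractf[symmetric] by (intro sum.cong) (simp_all add: algebra_simps)
    also have "(\<Sum>t\<le>s. real (Suc t) * c t * real (x choose Suc t))
        = (\<Sum>t\<le>Suc s. real t * c (t - 1) * real (x choose t))"
      by (subst sum.atMost_Suc_shift) simp
    also have "(\<Sum>t\<le>s. (a l - real t) * c t * real (x choose t))
        = (\<Sum>t\<le>Suc s. (if t \<le> s then (a l - real t) * c t else 0) * real (x choose t))"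
      by simp
    finally show ?thesis
      unfolding c'_def by (simp only: left_diff_distrib sum_subtractf)
  qed
  moreover have "c' (Suc s) = (- 1) ^ Suc s * fact (Suc s)"
    by (simp add: c'_def c(2))
  moreover have "card (insert l L) = Suc s" using insert.hyps by (simp add: s_def)
  ultimately show ?case by (intro exI[of _ c']) simp
qed

lemma card_le_Max_pos:
  assumes "finite L" "0 \<notin> L" "L \<noteq> {}"
  shows "card L \<le> Max (L :: nat set)"
proof -
  have "L \<subseteq> {1..Max L}" using assms by (auto simp: Suc_le_eq intro: gr0I)
  from card_mono[OF _ this] show ?thesis by simp
qed

text \<open>Induction by removing the maximum, which is at least \<open>card L\<close>.\<close>

lemma fact_card_le_prod:
  assumes "finite L" "0 \<notin> L"
  shows "fact (card L) \<le> \<Prod>(L :: nat set)"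
  using assms
proof (induction "card L" arbitrary: L)
  case (Suc n)
  define m where "m = Max L"
  have "L \<noteq> {}" using Suc.hyps(2) by auto
  then have m: "m \<in> L" "Suc n \<le> m"
    using Suc card_le_Max_pos[of L] by (auto simp: m_def)
  then have "n = card (L - {m})" using Suc.hyps(2) Suc.prems(1) by simp
  then have "fact n \<le> \<Prod>(L - {m})"
    using Suc.hyps(1)[of "L - {m}"] Suc.prems by simp
  then have "Suc n * fact n \<le> m * \<Prod>(L - {m})" using m(2) by (rule mult_le_mono[rotated])
  then show ?case using m(1) Suc.prems(1) Suc.hyps(2)[symmetric] by (simp add: prod.remove)
qed auto

text \<open>Since \<open>L\<close> is not an initial segment, its maximum is at least
  \<open>card L + 1\<close>, which improves the factorial bound by the factor
  \<open>(s + 1) / s\<close> with \<open>s = card L\<close>. This is the source of the constant in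
  the theorem.\<close>

lemma Suc_card_fact_le_prod:
  assumes "finite L" "0 \<notin> L" "L \<noteq> {1..card L}"
  shows "(card L + 1) * fact (card L) \<le> card L * \<Prod>(L :: nat set)"
proof (cases "card L")
  case 0
  then show ?thesis using assms by auto
next
  case (Suc n)
  define m where "m = Max L"
  have ne: "L \<noteq> {}" using Suc by auto
  have sub: "L \<subseteq> {1..m}" using assms by (auto simp: m_def Suc_le_eq intro: gr0I)
  have m: "m \<in> L" using assms(1) ne by (simp add: m_def)
  have "m \<noteq> card L" using sub assms(3) card_subset_eq[of "{1..m}" L] by auto
  then have "Suc (Suc n) \<le> m" using card_le_Max_pos[OF assms(1,2) ne] Suc by (simp add: m_def)
  moreover have "fact n \<le> \<Prod>(L - {m})"
    using fact_card_le_prod[of "L - {m}"] assms m Suc by simp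
  ultimately have "Suc (Suc n) * fact n \<le> m * \<Prod>(L - {m})" by (rule mult_le_mono)
  then have "Suc n * (Suc (Suc n) * fact n) \<le> Suc n * \<Prod>L"
    using m assms(1) by (simp only: prod.remove[of L m] mult_le_mono2)
  then show ?thesis using Suc by (simp add: algebra_simps)
qed

section \<open>Subsets of size below \<open>s\<close> are negligible\<close>

text \<open>For \<open>n \<ge> 2 * s\<close> the binomials increase up to \<open>s - 1\<close>, so
  each of the \<open>s\<close> layers is at most \<open>n choose (s - 1)\<close>; the ratio of
  consecutive binomials supplies the second factor \<open>s\<close>.\<close>

lemma card_small_subsets_le:
  assumes "s \<ge> 1" "n \<ge> 2 * s"
  shows "real (card {T. T \<subseteq> {1..n} \<and> card T < s}) * (real n - real s + 1) \<le> real s ^ 2 * real (n choose s)"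
proof -
  have "{T. T \<subseteq> {1..n} \<and> card T < s} = (\<Union>t<s. {T. T \<subseteq> {1..n} \<and> card T = t})" by auto
  then have "card {T. T \<subseteq> {1..n} \<and> card T < s} \<le> (\<Sum>t<s. card {T. T \<subseteq> {1..n} \<and> card T = t})"
    using card_UN_le[of "{..<s}" "\<lambda>t. {T. T \<subseteq> {1..n} \<and> card T = t}"] by simp
  also have "\<dots> = (\<Sum>t<s. n choose t)" by (simp add: n_subsets)
  also have "\<dots> \<le> s * (n choose (s - 1))"
    using sum_bounded_above[of "{..<s}" "\<lambda>t. n choose t" "n choose (s - 1)"] binomial_mono[of _ "s - 1" n] assms
    by auto
  finally have "real (card {T. T \<subseteq> {1..n} \<and> card T < s}) \<le> real s * real (n choose (s - 1))"
    by (metis of_nat_le_iff of_nat_mult)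
  then have "real (card {T. T \<subseteq> {1..n} \<and> card T < s}) * (real n - real s + 1)
      \<le> real s * (real (n choose (s - 1)) * (real n - real s + 1))"
    using assms mult_right_mono[of _ _ "real n - real s + 1"] by fastforce
  also have "real (n choose (s - 1)) * (real n - real s + 1) = real s * real (n choose s)"
    using gbinomial_mult_1[of "real n" "s - 1"] assms by (simp add: binomial_gbinomial algebra_simps of_nat_diff)
  finally show ?thesis by (simp add: power2_eq_square mult_ac)
qed

lemma card_small_subsets_negligible:
  fixes \<eta> :: real
  assumes "s \<ge> 1" "\<eta> > 0"
  shows "\<exists>n0. \<forall>n\<ge>n0. real (card {T. T \<subseteq> {1..n} \<and> card T < s}) \<le> \<eta> * real (n choose s)"
proof -
  obtain N :: nat where N: "real s ^ 2 / \<eta> \<le> real N" using real_arch_simple by blast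
  show ?thesis
  proof (intro exI[of _ "N + 2 * s"] allI impI)
    fix n assume n: "n \<ge> N + 2 * s"
    have pos: "real n - real s + 1 > 0" using n by linarith
    have "real s ^ 2 \<le> \<eta> * real N" using N assms(2) by (simp add: field_simps)
    also have "\<dots> \<le> \<eta> * (real n - real s + 1)" using assms(2) n by simp
    finally have "real s ^ 2 * real (n choose s) \<le> (\<eta> * (real n - real s + 1)) * real (n choose s)"
      by (rule mult_right_mono) simp
    also have "\<dots> = (\<eta> * real (n choose s)) * (real n - real s + 1)" by simp
    finally have "real s ^ 2 * real (n choose s) \<le> (\<eta> * real (n choose s)) * (real n - real s + 1)" .
    moreover have "real (card {T. T \<subseteq> {1..n} \<and> card T < s}) * (real n - real s + 1)
        \<le> real s ^ 2 * real (n choose s)"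
      using n by (intro card_small_subsets_le assms(1)) simp
    ultimately have "real (card {T. T \<subseteq> {1..n} \<and> card T < s}) * (real n - real s + 1)
        \<le> (\<eta> * real (n choose s)) * (real n - real s + 1)"
      by linarith
    then show "real (card {T. T \<subseteq> {1..n} \<and> card T < s}) \<le> \<eta> * real (n choose s)"
      using pos by simp
  qed
qed

section \<open>The Gram matrix of a differencing family\<close>

text \<open>Cutting along the cells of the Venn diagram separates the dependence on \<open>A\<close>
  from that on \<open>B\<close>, apart from one intersection size.\<close>

lemma card_Diff_via_base:
  assumes "finite A" "finite B" "finite C"
  shows "real (card (A - B)) = real (card (A - C)) + real (card (C - B))
    - real (card (((A - C) \<union> (C - A)) \<inter> ((B - C) \<union> (C - B))))"
proof -
  have d: "real (card U) = real (card (U \<inter> V)) + real (card (U - V))" if "finite U" for U V :: "'a set"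
    using card_Int_Diff[OF that, of V] by simp
  have 1: "real (card (A - C)) = real (card ((A - C) \<inter> B)) + real (card ((A - B) - C))"
    using d[of "A - C" B] assms by (simp add: Diff_eq Int_ac)
  have 2: "real (card (C - B)) = real (card ((A - B) \<inter> C)) + real (card ((C - B) - A))"
    using d[of "C - B" A] assms by (simp add: Diff_eq Int_ac)
  have 3: "real (card (A - B)) = real (card ((A - B) \<inter> C)) + real (card ((A - B) - C))"
    using d[of "A - B" C] assms by simp
  have "((A - C) \<union> (C - A)) \<inter> ((B - C) \<union> (C - B)) = ((A - C) \<inter> B) \<union> ((C - B) - A)" by auto
  moreover have "card (((A - C) \<inter> B) \<union> ((C - B) - A)) = card ((A - C) \<inter> B) + card ((C - B) - A)"
    by (rule card_Un_disjoint) (use assms in auto)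
  ultimately show ?thesis using 1 2 3 by simp
qed

text \<open>The left side is the top binomial in the expanded product. A lower binomial counts small
  sets \<open>T\<close> inside both \<open>Z A\<close> and \<open>Z B\<close>, hence factors, but
  its coefficient depends on \<open>card (A - A0) + card (A0 - B)\<close>. The first component of
  \<open>I\<close> runs over the possible values of \<open>card (A0 - B)\<close>, which separates
  \<open>A\<close> from \<open>B\<close>.\<close>

lemma differencing_gram_low_rank:
  fixes L :: "nat set" and F :: "nat set set" and n :: nat and A0 :: "nat set"
  assumes "finite L" "0 \<notin> L" and F: "F \<subseteq> Pow {1..n}" "differencing L F" "A0 \<in> F"
  defines "Z \<equiv> \<lambda>A. (A - A0) \<union> (A0 - A)"
  defines "E \<equiv> \<lambda>A. {S. S \<subseteq> Z A \<and> card S = card L}"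
  defines "I \<equiv> {..Max L} \<times> {T. T \<subseteq> {1..n} \<and> card T < card L}"
  shows "\<exists>a b. \<forall>A\<in>F. \<forall>B\<in>F. real (card (E A \<inter> E B))
    = (if A = B then real (\<Prod>L) / fact (card L) else 0) + (\<Sum>p\<in>I. a p A * b p B)"
proof -
  define s where "s = card L"
  define small where "small = {T. T \<subseteq> {1..n} \<and> card T < s}"
  have fin_small: "finite small" unfolding small_def by (rule finite_subset[of _ "Pow {1..n}"]) auto
  have "\<exists>c. (\<forall>x. (\<Prod>l\<in>L. (real M - real l) - real x) = (\<Sum>t\<le>s. c t * real (x choose t))) \<and>
    c s = (- 1) ^ s * fact s" for M :: nat
    unfolding s_def by (rule prod_diff_binomial_expansion[OF assms(1)])
  then obtain c :: "nat \<Rightarrow> nat \<Rightarrow> real" where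
    c: "\<And>M x. (\<Prod>l\<in>L. (real M - real l) - real x) = (\<Sum>t\<le>s. c M t * real (x choose t))"
      "\<And>M. c M s = (- 1) ^ s * fact s" by metis
  \<comment> \<open>The scalar inverts the leading coefficient \<open>(- 1) ^ s * fact s\<close>;
    the outer minus sign comes from moving the lower terms to the other side.\<close>
  define a where "a p A = - ((- 1) ^ s / fact s) * c (card (A - A0) + fst p) (card (snd p)) * of_bool (snd p \<subseteq> Z A)"
    for p :: "nat \<times> nat set" and A
  define b where "b p B = (of_bool (fst p = card (A0 - B)) * of_bool (snd p \<subseteq> Z B) :: real)"
    for p :: "nat \<times> nat set" and B
  have finF: "finite A" if "A \<in> F" for A using that F(1) finite_subset by blast
  have "real (card (E A \<inter> E B)) = (if A = B then real (\<Prod>L) / fact s else 0) + (\<Sum>p\<in>I. a p A * b p B)"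
    if AB: "A \<in> F" "B \<in> F" for A B
  proof -
    define x where "x = card (Z A \<inter> Z B)"
    define i where "i = card (A0 - B)"
    define M where "M = card (A - A0) + i"
    have Zn: "Z A \<subseteq> {1..n}" using AB(1) F(1,3) by (auto simp: Z_def)
    then have finZ: "finite (Z A \<inter> Z B)" using finite_subset by blast
    \<comment> \<open>The case \<open>B = A0\<close> gives 0, any other \<open>B\<close> a member of
      \<open>L\<close>; hence the index range includes 0.\<close>
    have i: "i \<le> Max L"
      using F(2,3) AB(2) assms(1) by (cases "A0 = B") (auto simp: i_def differencing_def)
    have AmB: "real (card (A - B)) = real M - real x"
      using card_Diff_via_base[of A B A0] finF AB F(3) by (simp add: M_def i_def x_def Z_def)
    have "(\<Prod>l\<in>L. (real M - real l) - real x) = (\<Prod>l\<in>L. real (card (A - B)) - real l)"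
      by (simp add: AmB algebra_simps)
    \<comment> \<open>On the diagonal \<open>card (A - B) = 0\<close>, leaving the factors
      \<open>- l\<close>; off the diagonal one factor vanishes.\<close>
    also have "\<dots> = (if A = B then (- 1) ^ s * real (\<Prod>L) else 0)"
    proof (cases "A = B")
      case True
      have "(\<Prod>l\<in>L. - real l) = (- 1) ^ s * (\<Prod>l\<in>L. real l)"
        unfolding s_def using prod.distrib[of "\<lambda>_. - 1 :: real" real L] by simp
      then show ?thesis using True by simp
    next
      case False
      then have "card (A - B) \<in> L" using F(2) AB by (auto simp: differencing_def)
      then show ?thesis using False assms(1) by auto
    qed
    also have "(\<Prod>l\<in>L. (real M - real l) - real x)
        = (\<Sum>t<s. c M t * real (x choose t)) + (- 1) ^ s * fact s * real (x choose s)"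
      by (simp add: c(1) c(2) lessThan_Suc_atMost[symmetric])
    also have "(\<Sum>t<s. c M t * real (x choose t)) = (\<Sum>T\<in>small. c M (card T) * of_bool (T \<subseteq> Z A \<inter> Z B))"
    proof -
      have "c M t * real (x choose t) = (\<Sum>T\<in>{T\<in>small. card T = t}. c M (card T) * of_bool (T \<subseteq> Z A \<inter> Z B))"
        if "t < s" for t
      proof -
        have "{T\<in>small. card T = t} \<inter> {T. T \<subseteq> Z A \<inter> Z B} = {T. T \<subseteq> Z A \<inter> Z B \<and> card T = t}"
          using that Zn by (auto simp: small_def)
        then have "(\<Sum>T\<in>{T\<in>small. card T = t}. of_bool (T \<subseteq> Z A \<inter> Z B)) = real (x choose t)"
          using fin_small n_subsets[OF finZ, of t] by (subst sum_of_bool_eq) (simp_all add: x_def)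
        moreover have "(\<Sum>T\<in>{T\<in>small. card T = t}. c M (card T) * of_bool (T \<subseteq> Z A \<inter> Z B))
            = c M t * (\<Sum>T\<in>{T\<in>small. card T = t}. of_bool (T \<subseteq> Z A \<inter> Z B))"
          unfolding sum_distrib_left by (rule sum.cong) auto
        ultimately show ?thesis by simp
      qed
      then have "(\<Sum>t<s. c M t * real (x choose t))
          = (\<Sum>t<s. \<Sum>T\<in>{T\<in>small. card T = t}. c M (card T) * of_bool (T \<subseteq> Z A \<inter> Z B))"
        by (intro sum.cong) auto
      also have "\<dots> = (\<Sum>T\<in>small. c M (card T) * of_bool (T \<subseteq> Z A \<inter> Z B))"
        by (rule sum.group[OF fin_small]) (auto simp: small_def)
      finally show ?thesis .
    qed
    finally have "(- 1) ^ s * fact s * real (x choose s) = (if A = B then (- 1) ^ s * real (\<Prod>L) else 0)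
        - (\<Sum>T\<in>small. c M (card T) * of_bool (T \<subseteq> Z A \<inter> Z B))" by linarith
    from arg_cong[OF this, of "\<lambda>y. ((- 1) ^ s / fact s) * y"]
    have "real (x choose s) = (if A = B then real (\<Prod>L) / fact s else 0)
        - ((- 1) ^ s / fact s) * (\<Sum>T\<in>small. c M (card T) * of_bool (T \<subseteq> Z A \<inter> Z B))"
      by (simp add: right_diff_distrib power_mult_distrib[symmetric] flip: mult.assoc split: if_splits)
    moreover have "(\<Sum>p\<in>I. a p A * b p B)
        = - ((- 1) ^ s / fact s) * (\<Sum>T\<in>small. c M (card T) * of_bool (T \<subseteq> Z A \<inter> Z B))"
    proof -
      have "(\<Sum>p\<in>I. a p A * b p B) = (\<Sum>i'\<le>Max L. \<Sum>T\<in>small. a (i', T) A * b (i', T) B)"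
        unfolding I_def small_def s_def by (simp add: sum.cartesian_product split_def)
      also have "\<dots> = (\<Sum>i'\<le>Max L. if i' = i then \<Sum>T\<in>small. a (i, T) A * b (i, T) B else 0)"
        by (intro sum.cong) (auto simp: b_def i_def)
      also have "\<dots> = (\<Sum>T\<in>small. a (i, T) A * b (i, T) B)"
        using i by simp
      also have "\<dots> = (\<Sum>T\<in>small. - ((- 1) ^ s / fact s) * (c M (card T) * of_bool (T \<subseteq> Z A \<inter> Z B)))"
        by (intro sum.cong) (auto simp: a_def b_def M_def i_def)
      finally show ?thesis by (simp only: sum_distrib_left)
    qed
    moreover have "card (E A \<inter> E B) = x choose s"
    proof -
      have "E A \<inter> E B = {S. S \<subseteq> Z A \<inter> Z B \<and> card S = s}" by (auto simp: E_def s_def)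
      then show ?thesis using n_subsets[OF finZ, of s] by (simp add: x_def)
    qed
    ultimately show ?thesis by simp
  qed
  then show ?thesis unfolding s_def by blast
qed

section \<open>Choice of constants and the asymptotic bound\<close>

theorem theorem1p2:
  fixes s :: nat and L :: "nat set"
  assumes "s \<ge> 1"
    and "finite L" and "card L = s" and "\<forall>l\<in>L. l > 0"
    and "L \<noteq> {1..s}"
  shows "\<forall>\<epsilon>::real. \<epsilon> > 0 \<longrightarrow>
    (\<exists>n0::nat. \<forall>n\<ge>n0. \<forall>F. F \<subseteq> Pow {1..n} \<and> differencing L F \<longrightarrow>
      real (card F) \<le> (real s / (real s + 1) + \<epsilon>) * real (n choose s))"
proof (intro allI impI)
  fix \<epsilon> :: real assume "\<epsilon> > 0"
  define r where "r = real s / (real s + 1)"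
  \<comment> \<open>Chosen so that \<open>\<delta> * (1 + r + \<epsilon>) \<le> \<epsilon>\<close>
    whenever \<open>r \<le> 1\<close>, which lets the final division by \<open>1 - \<delta>\<close>
    cost at most \<open>\<epsilon>\<close>.\<close>
  define \<delta> where "\<delta> = \<epsilon> / (2 + \<epsilon>)"
  have \<delta>: "0 < \<delta>" "\<delta> < 1" using \<open>\<epsilon> > 0\<close> by (auto simp: \<delta>_def)
  have "0 \<le> r" "r \<le> 1" by (auto simp: r_def)
  have r\<delta>: "r + \<delta> \<le> (r + \<epsilon>) * (1 - \<delta>)"
  proof -
    have "\<delta> * (1 + r + \<epsilon>) \<le> \<delta> * (2 + \<epsilon>)" using \<delta>(1) \<open>r \<le> 1\<close> by (intro mult_left_mono) auto
    also have "\<dots> = \<epsilon>" using \<open>\<epsilon> > 0\<close> by (simp add: \<delta>_def)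
    finally show ?thesis by (simp add: algebra_simps)
  qed
  define m where "m = Max L"
  have L0: "0 \<notin> L" using assms(4) by auto
  define \<mu> where "\<mu> = real (\<Prod>L) / fact s"
  have \<mu>: "1 / \<mu> \<le> r" "\<mu> > 0"
  proof -
    show "\<mu> > 0" using L0 assms(2) by (simp add: \<mu>_def prod_pos assms(4))
    have "(s + 1) * fact s \<le> s * \<Prod>L"
      using Suc_card_fact_le_prod[of L] assms L0 by simp
    then have "real ((s + 1) * fact s) \<le> real (s * \<Prod>L)" by (rule of_nat_mono)
    then have "(real s + 1) * fact s \<le> real s * real (\<Prod>L)" by (simp add: algebra_simps)
    then have "real s + 1 \<le> real s * \<mu>" by (simp add: \<mu>_def field_simps)
    then show "1 / \<mu> \<le> r" using \<open>\<mu> > 0\<close> by (simp add: r_def field_simps)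
  qed
  \<comment> \<open>\<open>C\<close> is fixed before \<open>n\<close> and \<open>F\<close>. The
    exponent is \<open>2 * m\<close> because each symmetric difference with the base set has at most
    \<open>2 * m\<close> elements.\<close>
  obtain C :: real where C: "C \<ge> 0" "\<forall>(F :: nat set set) (E :: nat set \<Rightarrow> nat set set) X
      (I :: (nat \<times> nat set) set) \<mu> a b.
    finite F \<and> finite X \<and> finite I \<and> \<mu> > 0 \<and> (\<forall>A\<in>F. E A \<subseteq> X \<and> card (E A) \<le> 2 ^ (2 * m)) \<and>
    (\<forall>A\<in>F. \<forall>B\<in>F. real (card (E A \<inter> E B)) = (if A = B then \<mu> else 0) + (\<Sum>i\<in>I. a i A * b i B))
    \<longrightarrow> (1 - \<delta>) * real (card F) \<le> real (card X) / \<mu> + C * real (card I)"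
    using card_le_of_gram_low_rank[OF \<delta>(1), of "2 ^ (2 * m)"] by (elim exE conjE) (rule that)
  \<comment> \<open>The factor \<open>m + 1\<close> counts the first components of the rank index
    set; the final \<open>+ 1\<close> keeps \<open>K\<close> positive when \<open>C = 0\<close>, as
    \<open>K\<close> is divided by.\<close>
  define K where "K = C * real (m + 1) + 1"
  have "K > 0" using C(1) by (auto simp: K_def intro!: add_nonneg_pos)
  with \<delta>(1) obtain n0 where n0: "\<And>n. n \<ge> n0 \<Longrightarrow>
      real (card {T. T \<subseteq> {1..n} \<and> card T < s}) \<le> \<delta> / K * real (n choose s)"
    using card_small_subsets_negligible[OF assms(1), of "\<delta> / K"] by auto
  show "\<exists>n0. \<forall>n\<ge>n0. \<forall>F. F \<subseteq> Pow {1..n} \<and> differencing L F \<longrightarrow>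
      real (card F) \<le> (real s / (real s + 1) + \<epsilon>) * real (n choose s)"
  proof (intro exI[of _ n0] allI impI, elim conjE)
    fix n F assume n: "n \<ge> n0" and F: "F \<subseteq> Pow {1..n}" "differencing L F"
    show "real (card F) \<le> (real s / (real s + 1) + \<epsilon>) * real (n choose s)"
    \<comment> \<open>The empty family has no member to serve as the base set
      \<open>A0\<close>.\<close>
    proof (cases "F = {}")
      case True
      then show ?thesis using \<open>\<epsilon> > 0\<close> by simp
    next
      case False
      then obtain A0 where A0: "A0 \<in> F" by blast
      define Z where "Z A = (A - A0) \<union> (A0 - A)" for A
      define E where "E A = {S. S \<subseteq> Z A \<and> card S = s}" for A
      define small where "small = {T. T \<subseteq> {1..n} \<and> card T < s}"
      define X where "X = {S. S \<subseteq> {1..n} \<and> card S = s}"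
      have cardX: "card X = n choose s" by (simp add: X_def n_subsets)
      have fins: "finite F" "finite X" "finite ({..m} \<times> small)"
        using F(1) finite_subset[of _ "Pow {1..n}"] by (auto simp: X_def small_def)
      have E: "E A \<subseteq> X \<and> card (E A) \<le> 2 ^ (2 * m)" if "A \<in> F" for A
      proof
        have Zn: "Z A \<subseteq> {1..n}" using that A0 F(1) by (auto simp: Z_def)
        then show "E A \<subseteq> X" by (auto simp: E_def X_def)
        have "card (A - A0) \<le> m \<and> card (A0 - A) \<le> m"
          using F(2) that A0 assms(2) by (cases "A = A0") (auto simp: differencing_def m_def)
        then have "card (Z A) \<le> 2 * m"
          using card_Un_le[of "A - A0" "A0 - A"] by (simp add: Z_def)
        moreover have "card (E A) = card (Z A) choose s"
          using finite_subset[OF Zn] by (simp add: E_def n_subsets)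
        ultimately show "card (E A) \<le> 2 ^ (2 * m)"
          using binomial_le_pow2[of "card (Z A)" s] power_increasing[of "card (Z A)" "2 * m" "2 :: nat"]
          by linarith
      qed
      obtain a b where gram: "\<forall>A\<in>F. \<forall>B\<in>F. real (card (E A \<inter> E B))
          = (if A = B then \<mu> else 0) + (\<Sum>p\<in>{..m} \<times> small. a p A * b p B)"
        using differencing_gram_low_rank[OF assms(2) L0 F A0]
        unfolding E_def Z_def small_def m_def \<mu>_def assms(3) by blast
      have "(1 - \<delta>) * real (card F) \<le> real (n choose s) / \<mu> + C * real (card ({..m} \<times> small))"
        unfolding cardX[symmetric]
        by (rule C(2)[rule_format, where E = E and a = a and b = b])
          (intro conjI fins \<mu>(2) gram ballI E)
      also have "C * real (card ({..m} \<times> small)) \<le> K * real (card small)"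
        by (simp add: K_def card_cartesian_product algebra_simps)
      also have "\<dots> \<le> \<delta> * real (n choose s)"
        using mult_left_mono[OF n0[OF n], of K] \<open>K > 0\<close> by (simp add: small_def)
      also have "real (n choose s) / \<mu> \<le> r * real (n choose s)"
        using mult_right_mono[OF \<mu>(1), of "real (n choose s)"] by simp
      finally have "(1 - \<delta>) * real (card F) \<le> (r + \<delta>) * real (n choose s)"
        by (simp add: algebra_simps)
      also have "\<dots> \<le> (1 - \<delta>) * ((r + \<epsilon>) * real (n choose s))"
        using mult_right_mono[OF r\<delta>, of "real (n choose s)"] by (simp add: mult_ac)
      finally show ?thesis using \<delta>(2) by (simp add: r_def)
    qed
  qed
qed

end
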